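(* Let $Q$ be a loop and $\alpha$, $\beta$ congruences of $Q$. Let $\mathcal W$ be defined as follows: (i) If $Q$ is a loop, let $\mathcal W = \{L_{x,y},R_{x,y},T_x,M_{x,y}\}$ or $\mathcal W=\{A_{x,y}^{\cdot},B_{x,y}^{\cdot},A_{x,y}^{\backslash}\}$. (ii) If $Q$ is an inverse property loop, let $\mathcal W = \{L_{x,y},T_x\}$ or $\mathcal W = \{M_{x,y}\}$. (iii) If $Q$ is a group, let $\mathcal W = \{T_x\}$. (iv) If $Q$ is a commutative loop, let $\mathcal W = \{L_{x,y},M_{x,y}\}$ or $\mathcal W=\{A_{x,y}^{\cdot},A_{x,y}^{\backslash}\}$. Then, in each case, $$[\alpha,\beta] = \mathrm{Cg}\big(\{(W_{\bar u}(a), W_{\bar v}(a)) : W\in\mathcal W,\ 1\,\alpha\,a,\ \bar u\,\beta\,\bar v\}\big).$$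
   Context: A loop is an algebra $(Q,1,\cdot,\backslash,/)$ satisfying $x\cdot 1=x=1\cdot x$, $x\backslash(x\cdot y)=y$, $x\cdot(x\backslash y)=y$, $(y\cdot x)/x=y$, $(y/x)\cdot x=y$. An inverse property loop is a loop with two-sided inverses $x^{-1}$ satisfying $x^{-1}(xy)=y=(yx)x^{-1}$. For $x\in Q$ define bijections of $Q$ by $L_x(y)=xy$, $R_x(y)=yx$, $M_x(y)=y\backslash x$. Put $$L_{x,y}=L_{xy}^{-1}L_xL_y,\quad R_{x,y}=R_{yx}^{-1}R_xR_y,\quad M_{x,y}=M_{y\backslash x}^{-1}M_xM_y,\quad T_x=R_x^{-1}L_x,$$ $$A^{\cdot}_{x,y}=R_{xy}^{-1}R_yR_x,\quad B^{\cdot}_{x,y}=R_{yx}^{-1}L_yR_x,\quad A^{\backslash}_{x,y}=R_{x\backslash y}^{-1}M_yR_x,$$ products being compositions of maps (right factor applied first). For such a $W$, $W_{\bar u}$ denotes the mapping obtained by substituting the elements $\bar u$ of $Q$ for the parameters of $W$ (one or two parameters). For congruences $\alpha,\beta,\delta$ of an algebra, $C(\alpha,\beta;\delta)$ means that for every $(n+1)$-ary term operation $t$, every $a\,\alpha\,b$ and every $u_1\,\beta\,v_1,\dots,u_n\,\beta\,v_n$, $t(a,u_1,\dots,u_n)\,\delta\,t(a,v_1,\dots,v_n)$ implies $t(b,u_1,\dots,u_n)\,\delta\,t(b,v_1,\dots,v_n)$. The commutator $[\alpha,\beta]$ is the smallest congruence $\delta$ with $C(\alpha,\beta;\delta)$.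 $\mathrm{Cg}(X)$ is the congruence generated by $X$. For tuples, $\bar u\,\beta\,\bar v$ means $u_i\,\beta\,v_i$ for all $i$. *)

theory Defs
  imports Main "HOL.Hull"
begin

class loop = times + one +
  fixes ldiv :: "'a \<Rightarrow> 'a \<Rightarrow> 'a"  (infixl "\<setminus>" 70)
    and rdiv :: "'a \<Rightarrow> 'a \<Rightarrow> 'a"  (infixl "\<sslash>" 70)
  assumes mult_one: "x * 1 = x"
    and one_mult: "1 * x = x"
    and ldiv_mult: "x \<setminus> (x * y) = y"
    and mult_ldiv: "x * (x \<setminus> y) = y"
    and mult_rdiv: "(y * x) \<sslash> x = y"
    and rdiv_mult: "(y \<sslash> x) * x = y"

definition inverse_property :: "('a::loop \<Rightarrow> 'a) \<Rightarrow> bool" where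
  "inverse_property i \<longleftrightarrow>
    (\<forall>x. i x * x = 1 \<and> x * i x = 1) \<and>
    (\<forall>x y. i x * (x * y) = y \<and> (y * x) * i x = y)"


section \<open>Inner mappings\<close>

definition L :: "'a::loop \<Rightarrow> 'a \<Rightarrow> 'a" where "L x = (\<lambda>y. x * y)"
definition R :: "'a::loop \<Rightarrow> 'a \<Rightarrow> 'a" where "R x = (\<lambda>y. y * x)"
definition M :: "'a::loop \<Rightarrow> 'a \<Rightarrow> 'a" where "M x = (\<lambda>y. y \<setminus> x)"

lemma bij_L: "bij (L x)"
  by (rule o_bij[where g = "\<lambda>y. x \<setminus> y"]) (auto simp: L_def fun_eq_iff ldiv_mult mult_ldiv)

lemma bij_R: "bij (R x)"
  by (rule o_bij[where g = "\<lambda>y. y \<sslash> x"]) (auto simp: R_def fun_eq_iff mult_rdiv rdiv_mult)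

lemma rdiv_ldiv: "(x \<sslash> y) \<setminus> x = (y::'a::loop)"
  by (metis ldiv_mult rdiv_mult)

lemma ldiv_rdiv: "x \<sslash> (y \<setminus> x) = (y::'a::loop)"
  by (metis mult_ldiv mult_rdiv)

lemma bij_M: "bij (M x)"
  by (rule o_bij[where g = "\<lambda>y. x \<sslash> y"]) (auto simp: M_def fun_eq_iff rdiv_ldiv ldiv_rdiv)

definition L_inner :: "'a::loop \<Rightarrow> 'a \<Rightarrow> 'a \<Rightarrow> 'a" where
  "L_inner x y = inv (L (x * y)) \<circ> L x \<circ> L y"

definition R_inner :: "'a::loop \<Rightarrow> 'a \<Rightarrow> 'a \<Rightarrow> 'a" where
  "R_inner x y = inv (R (y * x)) \<circ> R x \<circ> R y"

definition M_inner :: "'a::loop \<Rightarrow> 'a \<Rightarrow> 'a \<Rightarrow> 'a" where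
  "M_inner x y = inv (M (y \<setminus> x)) \<circ> M x \<circ> M y"

definition T_inner :: "'a::loop \<Rightarrow> 'a \<Rightarrow> 'a" where
  "T_inner x = inv (R x) \<circ> L x"

definition A_mult :: "'a::loop \<Rightarrow> 'a \<Rightarrow> 'a \<Rightarrow> 'a" where
  "A_mult x y = inv (R (x * y)) \<circ> R y \<circ> R x"

definition B_mult :: "'a::loop \<Rightarrow> 'a \<Rightarrow> 'a \<Rightarrow> 'a" where
  "B_mult x y = inv (R (y * x)) \<circ> L y \<circ> R x"

definition A_ldiv :: "'a::loop \<Rightarrow> 'a \<Rightarrow> 'a \<Rightarrow> 'a" where
  "A_ldiv x y = inv (R (x \<setminus> y)) \<circ> M y \<circ> R x"


section \<open>Congruences and the commutator\<close>

text \<open>Compatibility with the constant 1 is reflexivity.\<close>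

definition congruence :: "('a::loop) rel \<Rightarrow> bool" where
  "congruence \<theta> \<longleftrightarrow> equiv UNIV \<theta> \<and>
    (\<forall>x x' y y'. (x, x') \<in> \<theta> \<longrightarrow> (y, y') \<in> \<theta> \<longrightarrow>
      (x * y, x' * y') \<in> \<theta> \<and> (x \<setminus> y, x' \<setminus> y') \<in> \<theta> \<and> (x \<sslash> y, x' \<sslash> y') \<in> \<theta>)"

definition Cg :: "('a::loop) rel \<Rightarrow> 'a rel" where
  "Cg X = congruence hull X"

datatype (vars: 'v) loop_term =
    Var 'v
  | One
  | Mult "'v loop_term" "'v loop_term"
  | LDiv "'v loop_term" "'v loop_term"
  | RDiv "'v loop_term" "'v loop_term"

primrec eval :: "('v \<Rightarrow> 'a::loop) \<Rightarrow> 'v loop_term \<Rightarrow> 'a" where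
  "eval e (Var v) = e v"
| "eval e One = 1"
| "eval e (Mult s t) = eval e s * eval e t"
| "eval e (LDiv s t) = eval e s \<setminus> eval e t"
| "eval e (RDiv s t) = eval e s \<sslash> eval e t"

text \<open>
  A term with variables among 0, ..., k - 1 induces the k-ary term operation taking a tuple
  (a list \<open>xs\<close> of length k) to \<open>eval ((!) xs) t\<close>.
\<close>

definition centralizes :: "('a::loop) rel \<Rightarrow> 'a rel \<Rightarrow> 'a rel \<Rightarrow> bool" where
  "centralizes \<alpha> \<beta> \<delta> \<longleftrightarrow>
    (\<forall>n (t :: nat loop_term) a b us vs.
      vars t \<subseteq> {..<Suc n} \<longrightarrow> length us = n \<longrightarrow> length vs = n \<longrightarrow>
      (a, b) \<in> \<alpha> \<longrightarrow> (\<forall>i<n. (us ! i, vs ! i) \<in> \<beta>) \<longrightarrow>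
      (eval ((!) (a # us)) t, eval ((!) (a # vs)) t) \<in> \<delta> \<longrightarrow>
      (eval ((!) (b # us)) t, eval ((!) (b # vs)) t) \<in> \<delta>)"

text \<open>The order on relations is inclusion.\<close>

definition commutator :: "('a::loop) rel \<Rightarrow> 'a rel \<Rightarrow> 'a rel" where
  "commutator \<alpha> \<beta> = (LEAST \<delta>. congruence \<delta> \<and> centralizes \<alpha> \<beta> \<delta>)"

lemma congruence_Inter:
  assumes "\<And>\<theta>. \<theta> \<in> S \<Longrightarrow> congruence \<theta>"
  shows "congruence (\<Inter>S)"
  unfolding congruence_def
proof (intro conjI equivI)
  show "refl (\<Inter>S)"
    using assms by (auto simp: congruence_def equiv_def refl_on_def)
  show "sym (\<Inter>S)"
    by (rule sym_INTER[of S "\<lambda>\<theta>. \<theta>", simplified])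
      (use assms in \<open>auto simp: congruence_def equiv_def\<close>)
  show "trans (\<Inter>S)"
    by (rule trans_INTER[of S "\<lambda>\<theta>. \<theta>", simplified])
      (use assms in \<open>auto simp: congruence_def equiv_def\<close>)
qed (use assms in \<open>auto simp: congruence_def\<close>)

lemma commutator_eq_Inter:
  "commutator \<alpha> \<beta> = \<Inter>{\<delta>. congruence \<delta> \<and> centralizes \<alpha> \<beta> \<delta>}"
  unfolding commutator_def
proof (rule Least_equality)
  let ?S = "{\<delta>. congruence \<delta> \<and> centralizes \<alpha> \<beta> \<delta>}"
  have "centralizes \<alpha> \<beta> (\<Inter>?S)"
    unfolding centralizes_def[of \<alpha> \<beta> "\<Inter>?S"]
  proof (intro allI impI InterI)
    fix n and t :: "nat loop_term" and a b us vs \<delta>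
    assume *: "vars t \<subseteq> {..<Suc n}" "length us = n" "length vs = n" "(a, b) \<in> \<alpha>"
      "\<forall>i<n. (us ! i, vs ! i) \<in> \<beta>"
      "(eval ((!) (a # us)) t, eval ((!) (a # vs)) t) \<in> \<Inter>?S" and "\<delta> \<in> ?S"
    then have "centralizes \<alpha> \<beta> \<delta>" "(eval ((!) (a # us)) t, eval ((!) (a # vs)) t) \<in> \<delta>"
      by auto
    with * show "(eval ((!) (b # us)) t, eval ((!) (b # vs)) t) \<in> \<delta>"
      unfolding centralizes_def by blast
  qed
  moreover have "congruence (\<Inter>?S)"
    by (rule congruence_Inter) simp
  ultimately show "congruence (\<Inter>?S) \<and> centralizes \<alpha> \<beta> (\<Inter>?S)"
    by simp
qed auto


section \<open>Families of mappings depending on one or two parameters\<close>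

datatype 'a family =
    Family1 "'a \<Rightarrow> 'a \<Rightarrow> 'a"
  | Family2 "'a \<Rightarrow> 'a \<Rightarrow> 'a \<Rightarrow> 'a"

primrec pairs :: "('a::loop) rel \<Rightarrow> 'a rel \<Rightarrow> 'a family \<Rightarrow> 'a rel" where
  "pairs \<alpha> \<beta> (Family1 W) = {(W u a, W v a) | a u v. (1, a) \<in> \<alpha> \<and> (u, v) \<in> \<beta>}"
| "pairs \<alpha> \<beta> (Family2 W) = {(W u\<^sub>1 u\<^sub>2 a, W v\<^sub>1 v\<^sub>2 a) | a u\<^sub>1 u\<^sub>2 v\<^sub>1 v\<^sub>2.
      (1, a) \<in> \<alpha> \<and> (u\<^sub>1, v\<^sub>1) \<in> \<beta> \<and> (u\<^sub>2, v\<^sub>2) \<in> \<beta>}"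

end

theory Submission imports Defs begin

text \<open>
  Modulo a congruence \<open>\<delta>\<close>, call a family of mappings uniform if its values on the
  \<open>\<alpha>\<close>-class of 1 do not change when the parameters move within \<open>\<beta>\<close>-classes. If
  \<open>\<delta>\<close> centralizes \<open>\<alpha>\<close> and \<open>\<beta>\<close>, then every family of inner mappings given by a term is
  uniform, because a term fixing 1 takes the same value 1 for all parameters.

  Conversely, consider the matrices with rows \<open>(p, q)\<close> and \<open>(a p, a' q)\<close>, where
  \<open>p \<beta> q\<close>, \<open>1 \<alpha> a\<close> and \<open>a \<delta> a'\<close>. They include the
  generating matrices of the term condition, and if the upper row is in \<open>\<delta>\<close>, then so is the lower
  one. Uniformity of \<open>A\<^sup>\<cdot>\<close> and \<open>B\<^sup>\<cdot>\<close> makes them closed under multiplication. Closure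
  under both divisions is then automatic: a quotient is the unique solution of an equation, and the
  solution for the first column also solves the equation for the second one modulo
  \<open>\<delta>\<close>. So it suffices to derive uniformity of \<open>A\<^sup>\<cdot>\<close> and \<open>B\<^sup>\<cdot>\<close> from uniformity of
  the members of \<open>\<W>\<close>; in general \<open>L\<close>, \<open>R\<close> and \<open>T\<close> are enough, and \<open>M\<close> is only needed
  where it is the sole member.
\<close>

section \<open>Loops and their congruences\<close>

lemma inv_L: "inv (L x) = (\<lambda>y. x \<setminus> y)"
  by (rule inv_unique_comp) (auto simp: L_def fun_eq_iff ldiv_mult mult_ldiv)

lemma inv_R: "inv (R x) = (\<lambda>y. y \<sslash> x)"
  by (rule inv_unique_comp) (auto simp: R_def fun_eq_iff mult_rdiv rdiv_mult)

lemma inv_M: "inv (M x) = (\<lambda>y. x \<sslash> y)"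
  by (rule inv_unique_comp) (auto simp: M_def fun_eq_iff rdiv_ldiv ldiv_rdiv)

lemma inner_apply:
  "L_inner x y a = (x * y) \<setminus> (x * (y * a))"
  "R_inner x y a = ((a * y) * x) \<sslash> (y * x)"
  "M_inner x y a = (y \<setminus> x) \<sslash> ((a \<setminus> y) \<setminus> x)"
  "T_inner x a = (x * a) \<sslash> x"
  "A_mult x y a = ((a * x) * y) \<sslash> (x * y)"
  "B_mult x y a = (y * (a * x)) \<sslash> (y * x)"
  "A_ldiv x y a = ((a * x) \<setminus> y) \<sslash> (x \<setminus> y)"
  by (simp_all add: L_inner_def R_inner_def M_inner_def T_inner_def A_mult_def B_mult_def
      A_ldiv_def inv_L inv_R inv_M) (simp_all add: L_def R_def M_def)

lemma ldiv_self: "x \<setminus> x = (1::'a::loop)"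
  by (metis ldiv_mult mult_one)

lemma rdiv_self: "x \<sslash> x = (1::'a::loop)"
  by (metis mult_rdiv one_mult)

lemma one_ldiv: "1 \<setminus> x = (x::'a::loop)"
  by (metis ldiv_mult one_mult)

lemma rdiv_one: "x \<sslash> 1 = (x::'a::loop)"
  by (metis mult_rdiv mult_one)

lemmas loop_simps =
  mult_one one_mult ldiv_mult mult_ldiv mult_rdiv rdiv_mult ldiv_self rdiv_self one_ldiv rdiv_one

lemma congruence_refl: "congruence \<theta> \<Longrightarrow> (x, x) \<in> \<theta>"
  by (auto simp: congruence_def equiv_def refl_on_def)

lemma congruence_sym: "congruence \<theta> \<Longrightarrow> (x, y) \<in> \<theta> \<Longrightarrow> (y, x) \<in> \<theta>"
  by (auto simp: congruence_def equiv_def sym_def)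

lemma congruence_trans:
  "congruence \<theta> \<Longrightarrow> (x, y) \<in> \<theta> \<Longrightarrow> (y, z) \<in> \<theta> \<Longrightarrow> (x, z) \<in> \<theta>"
  by (auto simp: congruence_def equiv_def trans_def)

lemma congruence_ops:
  assumes "congruence \<theta>" "(x, x') \<in> \<theta>" "(y, y') \<in> \<theta>"
  shows "(x * y, x' * y') \<in> \<theta>" "(x \<setminus> y, x' \<setminus> y') \<in> \<theta>" "(x \<sslash> y, x' \<sslash> y') \<in> \<theta>"
  using assms by (auto simp: congruence_def)

lemmas congruence_intros = congruence_refl congruence_ops

lemma congruence_cancel_left:
  assumes "congruence \<theta>" "(x * y, x * z) \<in> \<theta>"
  shows "(y, z) \<in> \<theta>"
  using congruence_ops(2)[OF assms(1) congruence_refl[OF assms(1)] assms(2), of x]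
  by (simp add: loop_simps)

lemma congruence_cancel_right:
  assumes "congruence \<theta>" "(y * x, z * x) \<in> \<theta>"
  shows "(y, z) \<in> \<theta>"
  using congruence_ops(3)[OF assms congruence_refl[OF assms(1)], of x]
  by (simp add: loop_simps)

lemma congruence_Cg: "congruence (Cg X)"
  unfolding Cg_def hull_def by (rule congruence_Inter) auto

lemma subset_Cg: "X \<subseteq> Cg X"
  unfolding Cg_def by (rule hull_subset)


section \<open>Uniform families\<close>

text \<open>One-parameter families enter with a dummy second parameter, so that one notion serves
  both kinds of family.\<close>

definition uniform :: "('a::loop) rel \<Rightarrow> 'a rel \<Rightarrow> 'a rel \<Rightarrow> ('a \<Rightarrow> 'a \<Rightarrow> 'a \<Rightarrow> 'a) \<Rightarrow> bool" where
  "uniform \<alpha> \<beta> \<delta> W \<longleftrightarrow> (\<forall>a x x' y y'. (1, a) \<in> \<alpha> \<longrightarrow> (x, x') \<in> \<beta> \<longrightarrow> (y, y') \<in> \<beta> \<longrightarrow>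
    (W x y a, W x' y' a) \<in> \<delta>)"

lemma uniformI:
  assumes "\<And>a x x' y y'. (1, a) \<in> \<alpha> \<Longrightarrow> (x, x') \<in> \<beta> \<Longrightarrow> (y, y') \<in> \<beta> \<Longrightarrow>
    (W x y a, W x' y' a) \<in> \<delta>"
  shows "uniform \<alpha> \<beta> \<delta> W"
  using assms by (simp add: uniform_def)

lemma uniformD:
  assumes "uniform \<alpha> \<beta> \<delta> W" "(1, a) \<in> \<alpha>" "(x, x') \<in> \<beta>" "(y, y') \<in> \<beta>"
  shows "(W x y a, W x' y' a) \<in> \<delta>"
  using assms by (simp add: uniform_def)

lemma pairs_Family1_subset_iff:
  assumes "congruence \<beta>"
  shows "pairs \<alpha> \<beta> (Family1 W) \<subseteq> \<delta> \<longleftrightarrow> uniform \<alpha> \<beta> \<delta> (\<lambda>x y. W x)"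
  using congruence_refl[OF assms] by (fastforce simp: uniform_def)

lemma pairs_Family2_subset_iff:
  "pairs \<alpha> \<beta> (Family2 W) \<subseteq> \<delta> \<longleftrightarrow> uniform \<alpha> \<beta> \<delta> W"
  by (fastforce simp: uniform_def)

text \<open>Variable 0 carries the argument that moves from 1 to \<open>a\<close>; variables 1 and 2
  are the parameters. By \<open>one\<close>, the premise of the term condition relates 1 to
  itself.\<close>

lemma uniform_term:
  fixes \<delta> :: "('a::loop) rel" and t :: "nat loop_term"
  assumes \<delta>: "congruence \<delta>" and C: "centralizes \<alpha> \<beta> \<delta>" and t: "vars t \<subseteq> {..<3}"
    and one: "\<And>x y :: 'a. eval ((!) [1, x, y]) t = 1"
  shows "uniform \<alpha> \<beta> \<delta> (\<lambda>x y a. eval ((!) [a, x, y]) t)"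
proof (rule uniformI)
  fix a x x' y y'
  assume *: "(1, a) \<in> \<alpha>" "(x, x') \<in> \<beta>" "(y, y') \<in> \<beta>"
  have "vars t \<subseteq> {..<Suc 2}"
    using t by (simp add: numeral_3_eq_3)
  moreover have "\<forall>i<2. ([x, y] ! i, [x', y'] ! i) \<in> \<beta>"
    using * by (auto simp: less_Suc_eq numeral_2_eq_2)
  moreover have "(eval ((!) [1, x, y]) t, eval ((!) [1, x', y']) t) \<in> \<delta>"
    by (simp add: one congruence_refl \<delta>)
  ultimately show "(eval ((!) [a, x, y]) t, eval ((!) [a, x', y']) t) \<in> \<delta>"
    using C[unfolded centralizes_def, rule_format, of t 2 "[x, y]" "[x', y']" 1 a] *
    by simp
qed

lemma centralizes_imp_uniform:
  assumes "congruence \<delta>" "centralizes \<alpha> \<beta> \<delta>"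
  shows "uniform \<alpha> \<beta> \<delta> L_inner" "uniform \<alpha> \<beta> \<delta> R_inner" "uniform \<alpha> \<beta> \<delta> M_inner"
    "uniform \<alpha> \<beta> \<delta> (\<lambda>x y. T_inner x)"
    "uniform \<alpha> \<beta> \<delta> A_mult" "uniform \<alpha> \<beta> \<delta> B_mult" "uniform \<alpha> \<beta> \<delta> A_ldiv"
proof -
  let ?a = "Var (0::nat)" and ?x = "Var (1::nat)" and ?y = "Var (2::nat)"
  note U = uniform_term[OF assms]
  show "uniform \<alpha> \<beta> \<delta> L_inner"
    using U[of "LDiv (Mult ?x ?y) (Mult ?x (Mult ?y ?a))"]
    by (simp add: uniform_def inner_apply loop_simps)
  show "uniform \<alpha> \<beta> \<delta> R_inner"
    using U[of "RDiv (Mult (Mult ?a ?y) ?x) (Mult ?y ?x)"]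
    by (simp add: uniform_def inner_apply loop_simps)
  show "uniform \<alpha> \<beta> \<delta> M_inner"
    using U[of "RDiv (LDiv ?y ?x) (LDiv (LDiv ?a ?y) ?x)"]
    by (simp add: uniform_def inner_apply loop_simps)
  show "uniform \<alpha> \<beta> \<delta> (\<lambda>x y. T_inner x)"
    using U[of "RDiv (Mult ?x ?a) ?x"]
    by (simp add: uniform_def inner_apply loop_simps)
  show "uniform \<alpha> \<beta> \<delta> A_mult"
    using U[of "RDiv (Mult (Mult ?a ?x) ?y) (Mult ?x ?y)"]
    by (simp add: uniform_def inner_apply loop_simps)
  show "uniform \<alpha> \<beta> \<delta> B_mult"
    using U[of "RDiv (Mult ?y (Mult ?a ?x)) (Mult ?y ?x)"]
    by (simp add: uniform_def inner_apply loop_simps)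
  show "uniform \<alpha> \<beta> \<delta> A_ldiv"
    using U[of "RDiv (LDiv (Mult ?a ?x) ?y) (LDiv ?x ?y)"]
    by (simp add: uniform_def inner_apply loop_simps)
qed


section \<open>The term condition from uniformity\<close>

text \<open>The multipliers \<open>a\<close> and \<open>a'\<close> are eliminated as
  \<open>r \<sslash> p\<close> and \<open>s \<sslash> q\<close>. By cancellation,
  \<open>(p, r)\<close> in \<alpha> says that 1 is \<alpha>-related to the first multiplier.\<close>

definition matrix :: "('a::loop) rel \<Rightarrow> 'a rel \<Rightarrow> 'a rel \<Rightarrow> 'a \<Rightarrow> 'a \<Rightarrow> 'a \<Rightarrow> 'a \<Rightarrow> bool" where
  "matrix \<alpha> \<beta> \<delta> p q r s \<longleftrightarrow> (p, q) \<in> \<beta> \<and> (p, r) \<in> \<alpha> \<and> (r \<sslash> p, s \<sslash> q) \<in> \<delta>"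

locale uniform_A_B =
  fixes \<alpha> \<beta> \<delta> :: "('a::loop) rel"
  assumes \<alpha>: "congruence \<alpha>" and \<beta>: "congruence \<beta>" and \<delta>: "congruence \<delta>"
    and A: "uniform \<alpha> \<beta> \<delta> A_mult" and B: "uniform \<alpha> \<beta> \<delta> B_mult"
begin

lemma matrix_row:
  assumes "matrix \<alpha> \<beta> \<delta> p q r s" "(p, q) \<in> \<delta>"
  shows "(r, s) \<in> \<delta>"
proof -
  have "((r \<sslash> p) * p, (s \<sslash> q) * q) \<in> \<delta>"
    using assms congruence_ops(1)[OF \<delta>] by (simp add: matrix_def)
  then show ?thesis by (simp add: loop_simps)
qed

lemma matrix_unique:
  assumes "matrix \<alpha> \<beta> \<delta> p q r s" "matrix \<alpha> \<beta> \<delta> p q r s'"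
  shows "(s, s') \<in> \<delta>"
proof -
  have "(s \<sslash> q, s' \<sslash> q) \<in> \<delta>"
    using assms congruence_sym[OF \<delta>] congruence_trans[OF \<delta>] unfolding matrix_def by blast
  then have "((s \<sslash> q) * q, (s' \<sslash> q) * q) \<in> \<delta>"
    by (rule congruence_ops(1)[OF \<delta> _ congruence_refl[OF \<delta>]])
  then show ?thesis by (simp add: loop_simps)
qed

lemma matrix_subst:
  assumes "matrix \<alpha> \<beta> \<delta> p q r s" "(s, s') \<in> \<delta>"
  shows "matrix \<alpha> \<beta> \<delta> p q r s'"
proof -
  have "(s \<sslash> q, s' \<sslash> q) \<in> \<delta>"
    using assms(2) by (intro congruence_intros \<delta>)
  then show ?thesis
    using assms(1) congruence_trans[OF \<delta>] unfolding matrix_def by blast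
qed

lemma matrix_translate:
  assumes "(1, a) \<in> \<alpha>" "(p, q) \<in> \<beta>"
  shows "matrix \<alpha> \<beta> \<delta> p q (a * p) (a * q)"
  using assms congruence_ops(1)[OF \<alpha> assms(1) congruence_refl[OF \<alpha>], of p] congruence_refl[OF \<delta>]
  by (simp add: matrix_def loop_simps)

text \<open>At \<open>x\<close>, translating by \<open>c\<close> and then by \<open>d\<close> acts
  as the single translation by \<open>g * c\<close>. Uniformity of \<open>A_mult\<close> shows that
  the same \<open>g * c\<close> works at \<open>x'\<close> modulo \<delta>.\<close>

lemma left_translations_uniform:
  assumes "(1, c) \<in> \<alpha>" "(1, d) \<in> \<alpha>" "(x, x') \<in> \<beta>"
  shows "((d * (c * x)) \<sslash> x, (d * (c * x')) \<sslash> x') \<in> \<delta>"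
proof -
  define g where "g = ((d * (c * x)) \<sslash> x) \<sslash> c"
  have "(((1 * (1 * x)) \<sslash> x) \<sslash> 1, g) \<in> \<alpha>"
    unfolding g_def using assms by (intro congruence_intros \<alpha>)
  then have "(1, g) \<in> \<alpha>"
    by (simp add: loop_simps)
  \<comment> \<open>The element \<open>g\<close> is chosen so that \<open>A_mult c x g = d\<close>;
    only the second parameter moves.\<close>
  from uniformD[OF A this congruence_refl[OF \<beta>] assms(3), of c]
  have "(d, ((g * c) * x') \<sslash> (c * x')) \<in> \<delta>"
    by (simp add: inner_apply g_def loop_simps)
  then have "((d * (c * x')) \<sslash> x', ((((g * c) * x') \<sslash> (c * x')) * (c * x')) \<sslash> x') \<in> \<delta>"
    by (intro congruence_intros \<delta>)
  then have "((d * (c * x')) \<sslash> x', g * c) \<in> \<delta>"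
    by (simp add: loop_simps)
  then show ?thesis
    using congruence_sym[OF \<delta>] by (simp add: g_def loop_simps)
qed

text \<open>The multipliers are pulled out to the left one at a time: \<open>c\<close> replaces
  \<open>a\<close> in \<open>(a * p) * p'\<close>, and \<open>d\<close> then replaces
  \<open>a'\<close> in \<open>(a * p) * (a' * p')\<close>. This gives
  \<open>d * (c * (p * p'))\<close>, where the two translations are handled by
  \<open>left_translations_uniform\<close>.\<close>

lemma matrix_mult:
  assumes "matrix \<alpha> \<beta> \<delta> p q r s" "matrix \<alpha> \<beta> \<delta> p' q' r' s'"
  shows "matrix \<alpha> \<beta> \<delta> (p * p') (q * q') (r * r') (s * s')"
proof -
  define a a' where a: "a = r \<sslash> p" and a': "a' = r' \<sslash> p'"
  have pq: "(p, q) \<in> \<beta>" "(p', q') \<in> \<beta>"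
    and pr: "(p, r) \<in> \<alpha>" "(p', r') \<in> \<alpha>"
    using assms by (auto simp: matrix_def)
  have "(p \<sslash> p, a) \<in> \<alpha>" "(p' \<sslash> p', a') \<in> \<alpha>"
    unfolding a a' using pr by (auto intro!: congruence_intros \<alpha>)
  then have a1: "(1, a) \<in> \<alpha>" "(1, a') \<in> \<alpha>"
    by (simp_all add: loop_simps)
  have r: "r = a * p" "r' = a' * p'"
    by (simp_all add: a a' loop_simps)
  \<comment> \<open>From here the second column uses the same multipliers as the first, at the cost
    of a change modulo \<delta> that \<open>matrix_subst\<close> absorbs at the end.\<close>
  have s: "(s, a * q) \<in> \<delta>" "(s', a' * q') \<in> \<delta>"
    using matrix_unique[OF assms(1)[unfolded r]] matrix_unique[OF assms(2)[unfolded r]]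
      matrix_translate[OF a1(1) pq(1)] matrix_translate[OF a1(2) pq(2)] by blast+
  define c c' where c: "c = A_mult p p' a" and c': "c' = A_mult q q' a"
  define d d' where d: "d = B_mult p' (a * p) a'" and d': "d' = B_mult q' (a * q) a'"
  have ap: "(a * p, a * q) \<in> \<beta>"
    using pq by (intro congruence_intros \<beta>)
  have cc: "(c, c') \<in> \<delta>"
    unfolding c c' by (rule uniformD[OF A a1(1) pq])
  have dd: "(d, d') \<in> \<delta>"
    unfolding d d' by (rule uniformD[OF B a1(2) pq(2) ap])
  have "((1 * p * p') \<sslash> (p * p'), c) \<in> \<alpha>"
    "(((a * p) * (1 * p')) \<sslash> ((a * p) * p'), d) \<in> \<alpha>"
    unfolding c d inner_apply using a1 by (auto intro!: congruence_intros \<alpha>)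
  then have cd1: "(1, c) \<in> \<alpha>" "(1, d) \<in> \<alpha>"
    by (simp_all add: loop_simps)
  have pp: "(p * p', q * q') \<in> \<beta>"
    using pq by (intro congruence_intros \<beta>)
  have "((d * (c * (p * p'))) \<sslash> (p * p'), (d * (c * (q * q'))) \<sslash> (q * q')) \<in> \<delta>"
    by (rule left_translations_uniform[OF cd1 pp])
  moreover have "((d * (c * (q * q'))) \<sslash> (q * q'), (d' * (c' * (q * q'))) \<sslash> (q * q')) \<in> \<delta>"
    using cc dd by (intro congruence_intros \<delta>)
  ultimately have
    "((d * (c * (p * p'))) \<sslash> (p * p'), (d' * (c' * (q * q'))) \<sslash> (q * q')) \<in> \<delta>"
    by (rule congruence_trans[OF \<delta>])
  moreover have "d * (c * (p * p')) = r * r'" "d' * (c' * (q * q')) = (a * q) * (a' * q')"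
    by (simp_all add: c c' d d' r inner_apply loop_simps)
  ultimately have "((r * r') \<sslash> (p * p'), ((a * q) * (a' * q')) \<sslash> (q * q')) \<in> \<delta>"
    by simp
  moreover have "(p * p', r * r') \<in> \<alpha>"
    using pr by (intro congruence_intros \<alpha>)
  ultimately have "matrix \<alpha> \<beta> \<delta> (p * p') (q * q') (r * r') ((a * q) * (a' * q'))"
    using pp by (simp add: matrix_def)
  moreover have "((a * q) * (a' * q'), s * s') \<in> \<delta>"
    by (rule congruence_sym[OF \<delta>], rule congruence_ops(1)[OF \<delta> s])
  ultimately show ?thesis
    by (rule matrix_subst)
qed

text \<open>The multiplier \<open>r \<sslash> p\<close> of the first column is applied to
  \<open>q\<close>. This supplies the candidate quotient for both divisions.\<close>

lemma matrix_extend: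
  assumes "(p, q) \<in> \<beta>" "(p, r) \<in> \<alpha>"
  obtains s where "matrix \<alpha> \<beta> \<delta> p q r s"
proof -
  have "(p \<sslash> p, r \<sslash> p) \<in> \<alpha>"
    using assms(2) by (intro congruence_intros \<alpha>)
  then have "(1, r \<sslash> p) \<in> \<alpha>"
    by (simp add: loop_simps)
  from matrix_translate[OF this assms(1)] show ?thesis
    using that by (simp add: loop_simps)
qed

lemma matrix_ldiv:
  assumes "matrix \<alpha> \<beta> \<delta> p q r s" "matrix \<alpha> \<beta> \<delta> p' q' r' s'"
  shows "matrix \<alpha> \<beta> \<delta> (p \<setminus> p') (q \<setminus> q') (r \<setminus> r') (s \<setminus> s')"
proof -
  have "(p \<setminus> p', q \<setminus> q') \<in> \<beta>" "(p \<setminus> p', r \<setminus> r') \<in> \<alpha>"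
    using assms by (auto simp: matrix_def intro!: congruence_intros \<alpha> \<beta>)
  then obtain z where z: "matrix \<alpha> \<beta> \<delta> (p \<setminus> p') (q \<setminus> q') (r \<setminus> r') z"
    by (rule matrix_extend)
  \<comment> \<open>Multiplying by the candidate matrix restores \<open>p'\<close>,
    \<open>q'\<close> and \<open>r'\<close>, so \<open>s * z\<close> and \<open>s'\<close> complete
    the same three entries.\<close>
  have "(s * z, s * (s \<setminus> s')) \<in> \<delta>"
    using matrix_unique[OF _ assms(2)] matrix_mult[OF assms(1) z] by (simp add: loop_simps)
  with z show ?thesis
    using congruence_cancel_left[OF \<delta>] matrix_subst by blast
qed

lemma matrix_rdiv:
  assumes "matrix \<alpha> \<beta> \<delta> p q r s" "matrix \<alpha> \<beta> \<delta> p' q' r' s'"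
  shows "matrix \<alpha> \<beta> \<delta> (p \<sslash> p') (q \<sslash> q') (r \<sslash> r') (s \<sslash> s')"
proof -
  have "(p \<sslash> p', q \<sslash> q') \<in> \<beta>" "(p \<sslash> p', r \<sslash> r') \<in> \<alpha>"
    using assms by (auto simp: matrix_def intro!: congruence_intros \<alpha> \<beta>)
  then obtain z where z: "matrix \<alpha> \<beta> \<delta> (p \<sslash> p') (q \<sslash> q') (r \<sslash> r') z"
    by (rule matrix_extend)
  have "(z * s', (s \<sslash> s') * s') \<in> \<delta>"
    using matrix_unique[OF _ assms(1)] matrix_mult[OF z assms(2)] by (simp add: loop_simps)
  with z show ?thesis
    using congruence_cancel_right[OF \<delta>] matrix_subst by blast
qed

text \<open>This covers the distinguished argument of the term condition and, with both elements
  equal to 1, the constant \<open>One\<close>.\<close>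

lemma matrix_constant: "(a, b) \<in> \<alpha> \<Longrightarrow> matrix \<alpha> \<beta> \<delta> a a b b"
  by (simp add: matrix_def congruence_refl \<beta> \<delta>)

lemma matrix_parameter: "(u, v) \<in> \<beta> \<Longrightarrow> matrix \<alpha> \<beta> \<delta> u v u v"
  by (simp add: matrix_def congruence_refl \<alpha> \<delta> loop_simps)

lemma matrix_eval:
  assumes "\<And>i. i \<in> vars t \<Longrightarrow> matrix \<alpha> \<beta> \<delta> (e\<^sub>p i) (e\<^sub>q i) (e\<^sub>r i) (e\<^sub>s i)"
  shows "matrix \<alpha> \<beta> \<delta> (eval e\<^sub>p t) (eval e\<^sub>q t) (eval e\<^sub>r t) (eval e\<^sub>s t)"
  using assms
  by (induction t)
    (auto intro: matrix_mult matrix_ldiv matrix_rdiv matrix_constant congruence_refl[OF \<alpha>])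

lemma centralizes: "centralizes \<alpha> \<beta> \<delta>"
  unfolding centralizes_def
proof (intro allI impI)
  fix n a b us vs and t :: "nat loop_term"
  assume *: "vars t \<subseteq> {..<Suc n}" "length us = n" "length vs = n" "(a, b) \<in> \<alpha>"
    "\<forall>i<n. (us ! i, vs ! i) \<in> \<beta>" "(eval ((!) (a # us)) t, eval ((!) (a # vs)) t) \<in> \<delta>"
  have "matrix \<alpha> \<beta> \<delta> ((a # us) ! i) ((a # vs) ! i) ((b # us) ! i) ((b # vs) ! i)"
    if "i \<in> vars t" for i
  proof -
    have "i < Suc n"
      using that *(1) by blast
    then show ?thesis
      using *(2-5) by (cases i) (auto intro: matrix_constant matrix_parameter)
  qed
  then show "(eval ((!) (b # us)) t, eval ((!) (b # vs)) t) \<in> \<delta>"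
    using *(6) by (blast intro: matrix_row matrix_eval)
qed

end

text \<open>The third assumption puts \<open>Cg X\<close> below every centralizing congruence; the
  fourth, taken at \<open>Cg X\<close> itself, makes \<open>Cg X\<close> one of them.\<close>

lemma commutator_eq_Cg:
  fixes \<alpha> \<beta> X :: "('a::loop) rel"
  assumes "congruence \<alpha>" "congruence \<beta>"
    and "\<And>\<delta>. congruence \<delta> \<Longrightarrow> centralizes \<alpha> \<beta> \<delta> \<Longrightarrow> X \<subseteq> \<delta>"
    and "\<And>\<delta>. congruence \<delta> \<Longrightarrow> X \<subseteq> \<delta> \<Longrightarrow> uniform \<alpha> \<beta> \<delta> A_mult \<and> uniform \<alpha> \<beta> \<delta> B_mult"
  shows "commutator \<alpha> \<beta> = Cg X"
proof -
  interpret uniform_A_B \<alpha> \<beta> "Cg X"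
    using assms(1,2) assms(4)[OF congruence_Cg subset_Cg]
    by (simp add: uniform_A_B_def congruence_Cg)
  show ?thesis
    unfolding commutator_eq_Inter
  proof (intro subset_antisym)
    show "\<Inter>{\<delta>. congruence \<delta> \<and> centralizes \<alpha> \<beta> \<delta>} \<subseteq> Cg X"
      using centralizes \<delta> by blast
    show "Cg X \<subseteq> \<Inter>{\<delta>. congruence \<delta> \<and> centralizes \<alpha> \<beta> \<delta>}"
      using assms(3) unfolding Cg_def by (intro Inter_greatest hull_minimal) auto
  qed
qed


section \<open>Relations between the families\<close>

lemma uniform_T_inverse:
  assumes \<delta>: "congruence \<delta>" and \<alpha>: "congruence \<alpha>" and \<beta>: "congruence \<beta>"
    and T: "uniform \<alpha> \<beta> \<delta> (\<lambda>x y. T_inner x)"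
    and a: "(1, a) \<in> \<alpha>" and x: "(x, x') \<in> \<beta>"
  shows "(1, x \<setminus> (a * x)) \<in> \<alpha>" "(x \<setminus> (a * x), x' \<setminus> (a * x')) \<in> \<delta>"
proof -
  have "(x \<setminus> (1 * x), x \<setminus> (a * x)) \<in> \<alpha>"
    using a by (intro congruence_intros \<alpha>)
  then show b: "(1, x \<setminus> (a * x)) \<in> \<alpha>"
    by (simp add: loop_simps)
  \<comment> \<open>\<open>T_inner x\<close> sends \<open>x \<setminus> (a * x)\<close> back to
    \<open>a\<close>, so uniformity compares \<open>a\<close> with the value at \<open>x'\<close>,
    which is then undone by the inverse of \<open>T_inner x'\<close>.\<close>
  have "(a, (x' * (x \<setminus> (a * x))) \<sslash> x') \<in> \<delta>"
    using uniformD[OF T b x congruence_refl[OF \<beta>]] by (simp add: inner_apply loop_simps)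
  then have "(x' \<setminus> (a * x'), x' \<setminus> (((x' * (x \<setminus> (a * x))) \<sslash> x') * x')) \<in> \<delta>"
    by (intro congruence_intros \<delta>)
  then show "(x \<setminus> (a * x), x' \<setminus> (a * x')) \<in> \<delta>"
    using congruence_sym[OF \<delta>] by (simp add: loop_simps)
qed

text \<open>\<open>A_mult x y\<close> is \<open>R_inner y x\<close>.\<close>

lemma uniform_A_mult:
  assumes "uniform \<alpha> \<beta> \<delta> R_inner"
  shows "uniform \<alpha> \<beta> \<delta> A_mult"
  using assms by (simp add: uniform_def inner_apply)

text \<open>\<open>B\<^sup>\<cdot>\<^bsub>x,y\<^esub>\<close> is the composition of \<open>T\<^bsub>yx\<^esub>\<close>, \<open>L\<^bsub>y,x\<^esub>\<close>
  and the inverse of \<open>T\<^sub>x\<close>.\<close>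

lemma uniform_B_mult:
  assumes \<delta>: "congruence \<delta>" and \<alpha>: "congruence \<alpha>" and \<beta>: "congruence \<beta>"
    and L: "uniform \<alpha> \<beta> \<delta> L_inner" and T: "uniform \<alpha> \<beta> \<delta> (\<lambda>x y. T_inner x)"
  shows "uniform \<alpha> \<beta> \<delta> B_mult"
proof (rule uniformI)
  fix a x x' y y'
  assume a: "(1, a) \<in> \<alpha>" and xy: "(x, x') \<in> \<beta>" "(y, y') \<in> \<beta>"
  define b b' where b: "b = x \<setminus> (a * x)" and b': "b' = x' \<setminus> (a * x')"
  have b1: "(1, b) \<in> \<alpha>" and bb: "(b, b') \<in> \<delta>"
    using uniform_T_inverse[OF \<delta> \<alpha> \<beta> T a xy(1)] by (simp_all add: b b')
  define c c' where c: "c = L_inner y x b" and c': "c' = L_inner y' x' b'"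
  have "((y * x) \<setminus> (y * (x * 1)), c) \<in> \<alpha>"
    unfolding c inner_apply using b1 by (intro congruence_intros \<alpha>)
  then have c1: "(1, c) \<in> \<alpha>"
    by (simp add: loop_simps)
  \<comment> \<open>The parameters move first, by uniformity, and the argument afterwards, by
    compatibility of \<delta>; \<open>T_inner\<close> is treated likewise below.\<close>
  have "(c, L_inner y' x' b) \<in> \<delta>"
    unfolding c by (rule uniformD[OF L b1 xy(2,1)])
  moreover have "(L_inner y' x' b, c') \<in> \<delta>"
    unfolding c' inner_apply using bb by (intro congruence_intros \<delta>)
  ultimately have cc: "(c, c') \<in> \<delta>"
    by (rule congruence_trans[OF \<delta>])
  have "(T_inner (y * x) c, T_inner (y' * x') c) \<in> \<delta>"
    using xy by (intro uniformD[OF T c1 _ congruence_refl[OF \<beta>]] congruence_intros \<beta>)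
  moreover have "(T_inner (y' * x') c, T_inner (y' * x') c') \<in> \<delta>"
    unfolding inner_apply using cc by (intro congruence_intros \<delta>)
  ultimately have "(T_inner (y * x) c, T_inner (y' * x') c') \<in> \<delta>"
    by (rule congruence_trans[OF \<delta>])
  then show "(B_mult x y a, B_mult x' y' a) \<in> \<delta>"
    by (simp add: inner_apply c c' b b' loop_simps)
qed

section \<open>Inverse property loops\<close>

context
  fixes i :: "'a::loop \<Rightarrow> 'a" and \<alpha> \<beta> \<delta> :: "'a rel"
  assumes ip: "inverse_property i"
begin

lemma ip_simps: "i x * (x * y) = y" "(y * x) * i x = y" "i x * x = 1" "x * i x = 1"
  using ip by (auto simp: inverse_property_def)

lemma ip_eq_ldiv: "i x = x \<setminus> 1"
  by (metis ip_simps(4) ldiv_mult)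

lemma ip_ip: "i (i x) = x"
  by (metis ip_simps(1,3) mult_one)

text \<open>Cancelling \<open>y\<close> gives \<open>x = (x * y) * i y\<close>, hence
  \<open>i (x * y) * x = i y\<close>; now multiply by \<open>i x\<close> on the right.\<close>

lemma ip_mult: "i (x * y) = i y * i x"
  by (metis ip_simps)

lemma ip_ldiv: "x \<setminus> y = i x * y"
  by (metis ip_simps(1) mult_ldiv)

lemma ip_rdiv: "x \<sslash> y = x * i y"
  by (metis ip_simps(2) rdiv_mult)

lemma congruence_ip:
  assumes "congruence \<theta>" "(x, y) \<in> \<theta>"
  shows "(i x, i y) \<in> \<theta>"
  unfolding ip_eq_ldiv using assms by (intro congruence_intros)

lemma congruence_ip_one:
  assumes "congruence \<theta>" "(1, x) \<in> \<theta>"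
  shows "(1, i x) \<in> \<theta>"
  using congruence_ip[OF assms] by (simp add: ip_eq_ldiv loop_simps)

text \<open>Inversion is an antiautomorphism, so conjugating by it exchanges left and right
  translations.\<close>

lemma R_inner_ip: "R_inner x y a = i (L_inner (i x) (i y) (i a))"
  by (simp add: inner_apply ip_ldiv ip_rdiv ip_mult ip_ip)

lemma L_inner_ip: "L_inner x y a = i (R_inner (i x) (i y) (i a))"
  by (simp add: R_inner_ip ip_ip)

text \<open>Rewriting divisions as products with inverses turns \<open>M_inner x (i y) a\<close>
  into \<open>(y * x) * i ((y * a) * x)\<close>.\<close>

lemma M_inner_ip: "((y * a) * x) \<sslash> (y * x) = i (M_inner x (i y) a)"
  by (simp add: inner_apply ip_ldiv ip_rdiv ip_mult ip_ip)

lemma uniform_ip_conjugate: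
  assumes \<alpha>: "congruence \<alpha>" and \<beta>: "congruence \<beta>" and \<delta>: "congruence \<delta>"
    and W: "uniform \<alpha> \<beta> \<delta> W"
  shows "uniform \<alpha> \<beta> \<delta> (\<lambda>x y a. i (W (i x) (i y) (i a)))"
  by (intro uniformI congruence_ip[OF \<delta>] uniformD[OF W] congruence_ip_one[OF \<alpha>]
      congruence_ip[OF \<beta>])

lemma uniform_R_inner_ip:
  assumes "congruence \<alpha>" "congruence \<beta>" "congruence \<delta>" "uniform \<alpha> \<beta> \<delta> L_inner"
  shows "uniform \<alpha> \<beta> \<delta> R_inner"
  using uniform_ip_conjugate[OF assms] by (simp add: uniform_def R_inner_ip)

lemma uniform_L_inner_ip:
  assumes "congruence \<alpha>" "congruence \<beta>" "congruence \<delta>" "uniform \<alpha> \<beta> \<delta> R_inner"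
  shows "uniform \<alpha> \<beta> \<delta> L_inner"
  using uniform_ip_conjugate[OF assms] by (simp add: uniform_def L_inner_ip)

text \<open>Up to inversion, \<open>M\<^bsub>x,y\<^esub>\<close> is the map \<open>a \<mapsto> ((ya)x)/(yx)\<close> with \<open>y\<close> inverted. It yields
  \<open>T\<^sub>y\<close> for \<open>x = 1\<close>, and \<open>R\<^bsub>x,y\<^esub>\<close> by composing with the inverse of \<open>T\<^sub>y\<close>.\<close>

lemma uniform_M_inner_ip:
  assumes \<alpha>: "congruence \<alpha>" and \<beta>: "congruence \<beta>" and \<delta>: "congruence \<delta>"
    and M: "uniform \<alpha> \<beta> \<delta> M_inner"
  shows "uniform \<alpha> \<beta> \<delta> (\<lambda>x y. T_inner x)" "uniform \<alpha> \<beta> \<delta> R_inner"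
proof -
  have V: "(((y * a) * x) \<sslash> (y * x), ((y' * a) * x') \<sslash> (y' * x')) \<in> \<delta>"
    if "(1, a) \<in> \<alpha>" "(x, x') \<in> \<beta>" "(y, y') \<in> \<beta>" for a x x' y y'
    unfolding M_inner_ip using that
    by (intro congruence_ip[OF \<delta>] uniformD[OF M] congruence_ip[OF \<beta>])
  show T: "uniform \<alpha> \<beta> \<delta> (\<lambda>x y. T_inner x)"
    using V[where x = 1 and x' = 1] congruence_refl[OF \<beta>]
    by (simp add: uniform_def inner_apply loop_simps)
  show "uniform \<alpha> \<beta> \<delta> R_inner"
  proof (rule uniformI)
    fix a x x' y y'
    assume a: "(1, a) \<in> \<alpha>" and xy: "(x, x') \<in> \<beta>" "(y, y') \<in> \<beta>"
    define b b' where b: "b = y \<setminus> (a * y)" and b': "b' = y' \<setminus> (a * y')"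
    have b1: "(1, b) \<in> \<alpha>" and bb: "(b, b') \<in> \<delta>"
      using uniform_T_inverse[OF \<delta> \<alpha> \<beta> T a xy(2)] by (simp_all add: b b')
    have "(((y * b) * x) \<sslash> (y * x), ((y' * b) * x') \<sslash> (y' * x')) \<in> \<delta>"
      by (rule V[OF b1 xy])
    moreover have "(((y' * b) * x') \<sslash> (y' * x'), ((y' * b') * x') \<sslash> (y' * x')) \<in> \<delta>"
      using bb by (intro congruence_intros \<delta>)
    ultimately have "(((y * b) * x) \<sslash> (y * x), ((y' * b') * x') \<sslash> (y' * x')) \<in> \<delta>"
      by (rule congruence_trans[OF \<delta>])
    then show "(R_inner x y a, R_inner x' y' a) \<in> \<delta>"
      by (simp add: inner_apply b b' loop_simps)
  qed
qed

end

section \<open>Groups and commutative loops\<close>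

lemma uniform_inner_group:
  fixes i :: "'a::loop \<Rightarrow> 'a" and \<delta> :: "'a rel"
  assumes "group (*) 1 i" "congruence \<delta>"
  shows "uniform \<alpha> \<beta> \<delta> L_inner" "uniform \<alpha> \<beta> \<delta> R_inner"
proof -
  have assoc: "(x * y) * z = x * (y * z)" for x y z :: 'a
    using assms(1) by (simp add: group_def semigroup_def)
  \<comment> \<open>By associativity these inner mappings are the identity, so they are uniform
    modulo any congruence.\<close>
  have "L_inner x y a = a" for x y a :: 'a
    by (simp add: inner_apply assoc[symmetric] ldiv_mult)
  moreover have "R_inner x y a = a" for x y a :: 'a
    by (simp add: inner_apply assoc mult_rdiv)
  ultimately show "uniform \<alpha> \<beta> \<delta> L_inner" "uniform \<alpha> \<beta> \<delta> R_inner"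
    by (simp_all add: uniform_def congruence_refl[OF assms(2)])
qed

text \<open>Under commutativity the two divisions agree up to the order of their arguments, so
  uniformity of either \<open>L_inner\<close> or \<open>A_mult\<close> decides everything.\<close>

lemma commutative_families:
  assumes "\<forall>x y :: 'a::loop. x * y = y * x"
  shows "A_mult x y a = L_inner y x (a :: 'a)" "B_mult x y a = A_mult x y a"
proof -
  have "z \<sslash> x = x \<setminus> z" for x z :: 'a
    by (metis assms ldiv_mult rdiv_mult)
  moreover have "(a * x) * y = y * (x * a)" "x * y = y * x" "a * x = x * a"
    by (metis assms)+
  ultimately show "A_mult x y a = L_inner y x a" "B_mult x y a = A_mult x y a"
    by (simp_all add: inner_apply)
qed

theorem corollary5p2:
  fixes \<alpha> \<beta> :: "('a::loop) rel"
    and \<W> :: "'a family set"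
  assumes "congruence \<alpha>" and "congruence \<beta>"
    and "\<W> \<in> {{Family2 L_inner, Family2 R_inner, Family1 T_inner, Family2 M_inner},
              {Family2 A_mult, Family2 B_mult, Family2 A_ldiv}} \<or>
         (\<exists>i :: 'a \<Rightarrow> 'a. inverse_property i) \<and>
           \<W> \<in> {{Family2 L_inner, Family1 T_inner}, {Family2 M_inner}} \<or>
         (\<exists>i :: 'a \<Rightarrow> 'a. group (*) 1 i) \<and>
           \<W> \<in> {{Family1 T_inner}} \<or>
         (\<forall>x y :: 'a. x * y = y * x) \<and>
           \<W> \<in> {{Family2 L_inner, Family2 M_inner}, {Family2 A_mult, Family2 A_ldiv}}"
  shows "commutator \<alpha> \<beta> = Cg (\<Union>W\<in>\<W>. pairs \<alpha> \<beta> W)"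
proof (rule commutator_eq_Cg)
  note iffs = pairs_Family1_subset_iff[OF assms(2)] pairs_Family2_subset_iff
  \<comment> \<open>All seven families are given by terms fixing 1, so one argument settles this
    inclusion in every case.\<close>
  have W: "\<W> \<subseteq> {Family2 L_inner, Family2 R_inner, Family1 T_inner, Family2 M_inner,
      Family2 A_mult, Family2 B_mult, Family2 A_ldiv}"
    using assms(3) by (elim disjE conjE exE insertE emptyE) simp_all
  show "(\<Union>W\<in>\<W>. pairs \<alpha> \<beta> W) \<subseteq> \<delta>" if "congruence \<delta>" "centralizes \<alpha> \<beta> \<delta>" for \<delta>
  proof (rule UN_least)
    fix W
    assume "W \<in> \<W>"
    with W have "W \<in> {Family2 L_inner, Family2 R_inner, Family1 T_inner, Family2 M_inner,
      Family2 A_mult, Family2 B_mult, Family2 A_ldiv}"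
      by (rule subsetD)
    then show "pairs \<alpha> \<beta> W \<subseteq> \<delta>"
      using centralizes_imp_uniform[OF that]
      by (elim insertE emptyE) (simp_all only: iffs)
  qed
  fix \<delta> :: "'a rel"
  assume \<delta>: "congruence \<delta>" and X: "(\<Union>W\<in>\<W>. pairs \<alpha> \<beta> W) \<subseteq> \<delta>"
  let ?U = "uniform \<alpha> \<beta> \<delta>"
  have X0: "pairs \<alpha> \<beta> W \<subseteq> \<delta>" if "W \<in> \<W>" for W
    using X that by blast
  have X1: "?U (\<lambda>x y. W x)" if "Family1 W \<in> \<W>" for W
    by (rule iffD1[OF iffs(1) X0[OF that]])
  have X2: "?U W" if "Family2 W \<in> \<W>" for W
    by (rule iffD1[OF iffs(2) X0[OF that]])
  have LRT: "?U A_mult \<and> ?U B_mult"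
    if "?U L_inner" "?U R_inner" "?U (\<lambda>x y. T_inner x)"
    using that by (simp add: uniform_A_mult uniform_B_mult[OF \<delta> assms(1,2)])
  have commutative: "?U A_mult \<and> ?U B_mult"
    if "\<forall>x y :: 'a. x * y = y * x" "?U L_inner \<or> ?U A_mult"
    using that(2) by (auto simp: uniform_def commutative_families[OF that(1)])
  from assms(3) show "?U A_mult \<and> ?U B_mult"
  proof (elim disjE conjE exE)
    assume "\<W> \<in> {{Family2 L_inner, Family2 R_inner, Family1 T_inner, Family2 M_inner},
      {Family2 A_mult, Family2 B_mult, Family2 A_ldiv}}"
    then show ?thesis
      using LRT X1 X2 by blast
  next
    fix i :: "'a \<Rightarrow> 'a"
    assume ip: "inverse_property i"
      and "\<W> \<in> {{Family2 L_inner, Family1 T_inner}, {Family2 M_inner}}"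
    then have "?U L_inner \<and> ?U (\<lambda>x y. T_inner x) \<or> ?U M_inner"
      using X1 X2 by blast
    then show ?thesis
    proof (elim disjE conjE)
      assume L: "?U L_inner" and T: "?U (\<lambda>x y. T_inner x)"
      show ?thesis
        by (rule LRT[OF L uniform_R_inner_ip[OF ip assms(1,2) \<delta> L] T])
    next
      assume "?U M_inner"
      note TR = uniform_M_inner_ip[OF ip assms(1,2) \<delta> this]
      show ?thesis
        by (rule LRT[OF uniform_L_inner_ip[OF ip assms(1,2) \<delta> TR(2)] TR(2,1)])
    qed
  next
    fix i :: "'a \<Rightarrow> 'a"
    assume G: "group (*) 1 i" and "\<W> \<in> {{Family1 T_inner}}"
    then have "Family1 T_inner \<in> \<W>"
      by simp
    from LRT[OF uniform_inner_group[OF G \<delta>] X1[OF this]] show ?thesis .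
  next
    assume C: "\<forall>x y :: 'a. x * y = y * x"
      and W: "\<W> \<in> {{Family2 L_inner, Family2 M_inner}, {Family2 A_mult, Family2 A_ldiv}}"
    have "?U L_inner \<or> ?U A_mult"
      using W X2 by blast
    then show ?thesis
      by (rule commutative[OF C])
  qed
qed (rule assms)+

end
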